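(* Let $\mathcal{K}\subset\mathbb{R}^m$ be a proper convex cone whose dual cone $\mathcal{K}^*$ admits a self-concordant barrier (SCB) $f:(\mathcal{K}^* )^\circ\to\mathbb{R}$ with gradient $g$ and Hessian $H$, and let $B(y)=H(y)+g(y)g(y)^{\mathrm T}$ for $y\in(\mathcal{K}^* )^\circ$. Then for every $y\in(\mathcal{K}^* )^\circ$ and every $z\in\mathcal{K}^*$, $$B(y)z\in\mathcal{K}.$$ If, moreover, $\mathcal{K}^*$ is the hyperbolicity cone of a hyperbolic polynomial $p$ and $f$ is the logarithmic barrier $f(y)=-\ln(p(y))$, then also $$H(y)z\in\mathcal{K}$$ for every $y\in(\mathcal{K}^* )^\circ$ and every $z\in\mathcal{K}^*$.
   Context: A proper convex cone is a closed convex cone that is pointed and has non-empty interior. $\mathcal{C}^\circ$ denotes the interior of $\mathcal{C}$. The dual cone of $\mathcal{K}\subset\mathbb{R}^m$ is $\mathcal{K}^*=\{y\in\mathbb{R}^m : x^{\mathrm T}y\ge 0 \text{ for all } x\in\mathcal{K}\}$. A (strongly nondegenerate) self-concordant barrier (SCB) for a convex cone $\mathcal{C}$ with non-empty interior is a strictly convex, at least three times differentiable function $f:\mathcal{C}^\circ\to\mathbb{R}$ with positive definite Hessian everywhere such that, with $g$ and $H$ denoting the gradient and Hessian of $f$: (1) $f(x)\to\infty$ as $x$ tends to the boundary of $\mathcal{C}$; (2) $|D^3f(x)[h,h,h]|\le 2\,(D^2f(x)[h,h])^{3/2}$ for all $x\in\mathcal{C}^\circ$ and all directions $h$; (3) $\nu:=\sup_{x\in\mathcal{C}^\circ}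 g(x)^{\mathrm T}H(x)^{-1}g(x)<\infty$. A homogeneous real polynomial $p$ on $\mathbb{R}^m$ is hyperbolic with respect to $e\in\mathbb{R}^m$ if $p(e)>0$ and for every $x\in\mathbb{R}^m$ the univariate polynomial $t\mapsto p(te-x)$ has only real roots; its (closed) hyperbolicity cone is the set of $x$ for which all of these roots are nonnegative. *)

theory Defs
  imports
    "HOL-Analysis.Analysis"
    "HOL-Library.Poly_Mapping"
    "HOL-Computational_Algebra.Polynomial"
begin

section \<open>Cones\<close>

definition proper_cone :: "(real ^ 'm) set \<Rightarrow> bool" where
  "proper_cone K \<longleftrightarrow>
     convex_cone K \<and> closed K \<and> K \<inter> uminus ` K = {0} \<and> interior K \<noteq> {}"

definition dual_cone :: "(real ^ 'm) set \<Rightarrow> (real ^ 'm) set" where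
  "dual_cone K = {y. \<forall>x\<in>K. 0 \<le> x \<bullet> y}"


section \<open>Gradient and Hessian\<close>

text \<open>Both are meaningful only at points where the derivative in question exists.\<close>

definition gradient :: "(real ^ 'm \<Rightarrow> real) \<Rightarrow> real ^ 'm \<Rightarrow> real ^ 'm" where
  "gradient f x = (THE d. GDERIV f x :> d)"

definition hessian :: "(real ^ 'm \<Rightarrow> real) \<Rightarrow> real ^ 'm \<Rightarrow> real ^ 'm ^ 'm" where
  "hessian f x = jacobian (gradient f) (at x)"

lemma GDERIV_gradient:
  assumes "f differentiable (at x)"
  shows "GDERIV f x :> gradient f x"
proof -
  from assms obtain f' where f': "(f has_derivative f') (at x)"
    by (auto simp: differentiable_def)
  then have "linear f'" by (rule has_derivative_linear)
  then have "f' h = h \<bullet> adjoint f' 1" for h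
    using adjoint_works[of f' h 1] by simp
  then have "f' = (\<lambda>h. h \<bullet> adjoint f' 1)" by (rule ext)
  then have ex: "GDERIV f x :> adjoint f' 1"
    unfolding gderiv_def by (rule subst) (rule f')
  have uniq: "d = d'" if "GDERIV f x :> d" "GDERIV f x :> d'" for d d'
  proof -
    have "(\<lambda>h. h \<bullet> d) = (\<lambda>h. h \<bullet> d')"
      using that unfolding gderiv_def by (rule has_derivative_unique)
    then have "\<forall>h. h \<bullet> d = h \<bullet> d'" by (simp add: fun_eq_iff)
    then show ?thesis by (simp only: vector_eq_ldot)
  qed
  show ?thesis
    unfolding gradient_def by (rule theI[where P = "\<lambda>d. GDERIV f x :> d", OF ex uniq[OF _ ex]])
qed


section \<open>Self-concordant barriers\<close>

text \<open>
  A barrier is a total function of which only the values on \<open>interior C\<close> matter.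
  The derivatives of order two and three are
  \<open>D\<^sup>2f(x)[h,h] = h \<bullet> (hessian f x *v h)\<close> and
  \<open>D\<^sup>3f(x)[h,h,h] = h \<bullet> (frechet_derivative (hessian f) (at x) h *v h)\<close>.
\<close>

definition strictly_convex_on :: "(real ^ 'm) set \<Rightarrow> (real ^ 'm \<Rightarrow> real) \<Rightarrow> bool" where
  "strictly_convex_on S f \<longleftrightarrow> convex S \<and>
     (\<forall>x\<in>S. \<forall>y\<in>S. \<forall>t. x \<noteq> y \<and> 0 < t \<and> t < 1 \<longrightarrow>
        f ((1 - t) *\<^sub>R x + t *\<^sub>R y) < (1 - t) * f x + t * f y)"

definition three_times_differentiable_on ::
    "(real ^ 'm) set \<Rightarrow> (real ^ 'm \<Rightarrow> real) \<Rightarrow> bool" where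
  "three_times_differentiable_on S f \<longleftrightarrow>
     (\<forall>x\<in>S. f differentiable (at x) \<and> gradient f differentiable (at x)
        \<and> hessian f differentiable (at x))"

definition self_concordant_barrier ::
    "(real ^ 'm) set \<Rightarrow> (real ^ 'm \<Rightarrow> real) \<Rightarrow> bool" where
  "self_concordant_barrier C f \<longleftrightarrow>
     convex_cone C \<and> interior C \<noteq> {} \<and>
     strictly_convex_on (interior C) f \<and>
     three_times_differentiable_on (interior C) f \<and>
     (\<forall>x\<in>interior C. \<forall>h. h \<noteq> 0 \<longrightarrow> 0 < h \<bullet> (hessian f x *v h)) \<and>
     (\<forall>b\<in>frontier C. filterlim f at_top (at b within interior C)) \<and>
     (\<forall>x\<in>interior C. \<forall>h.
        \<bar>h \<bullet> (frechet_derivative (hessian f) (at x) h *v h)\<bar>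
          \<le> 2 * (h \<bullet> (hessian f x *v h)) powr (3 / 2)) \<and>
     bdd_above ((\<lambda>x. gradient f x \<bullet> (matrix_inv (hessian f x) *v gradient f x)) ` interior C)"

text \<open>\<open>B(y) = H(y) + g(y) g(y)\<^sup>T\<close>\<close>

definition augmented_hessian :: "(real ^ 'm \<Rightarrow> real) \<Rightarrow> real ^ 'm \<Rightarrow> real ^ 'm ^ 'm" where
  "augmented_hessian f y =
     hessian f y + (columnvector (gradient f y) :: real ^ 1 ^ 'm) ** rowvector (gradient f y)"


section \<open>Hyperbolic polynomials\<close>

text \<open>
  A polynomial in the variables \<open>x\<^sub>i\<close>, \<open>i :: 'm\<close>, is the finitely supported map from
  exponent vectors to coefficients.
\<close>

type_synonym 'm mpoly = "('m \<Rightarrow>\<^sub>0 nat) \<Rightarrow>\<^sub>0 real"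

definition mpoly_eval :: "'m::finite mpoly \<Rightarrow> real ^ 'm \<Rightarrow> real" where
  "mpoly_eval p x =
     (\<Sum>a\<in>Poly_Mapping.keys p. Poly_Mapping.lookup p a * (\<Prod>i\<in>UNIV. (x $ i) ^ Poly_Mapping.lookup a i))"

definition homogeneous :: "'m::finite mpoly \<Rightarrow> bool" where
  "homogeneous p \<longleftrightarrow> (\<exists>d. \<forall>a\<in>Poly_Mapping.keys p. (\<Sum>i\<in>UNIV. Poly_Mapping.lookup a i) = d)"

text \<open>The univariate polynomial \<open>t \<mapsto> p(te - x)\<close>.\<close>

definition line_poly :: "'m::finite mpoly \<Rightarrow> real ^ 'm \<Rightarrow> real ^ 'm \<Rightarrow> real poly" where
  "line_poly p e x =
     (\<Sum>a\<in>Poly_Mapping.keys p. smult (Poly_Mapping.lookup p a) (\<Prod>i\<in>UNIV. [:- (x $ i), e $ i:] ^ Poly_Mapping.lookup a i))"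

lemma poly_line_poly: "poly (line_poly p e x) t = mpoly_eval p (t *\<^sub>R e - x)"
  by (simp add: line_poly_def mpoly_eval_def poly_sum poly_prod)

definition hyperbolic :: "'m::finite mpoly \<Rightarrow> real ^ 'm \<Rightarrow> bool" where
  "hyperbolic p e \<longleftrightarrow> homogeneous p \<and> 0 < mpoly_eval p e \<and>
     (\<forall>x. \<forall>t::complex. poly (map_poly complex_of_real (line_poly p e x)) t = 0 \<longrightarrow> t \<in> \<real>)"

text \<open>
  For hyperbolic \<open>p\<close> all complex roots of \<open>line_poly p e x\<close> are real, so that
  ranging over the real roots is enough.
\<close>

definition hyperbolicity_cone :: "'m::finite mpoly \<Rightarrow> real ^ 'm \<Rightarrow> (real ^ 'm) set" where
  "hyperbolicity_cone p e = {x. \<forall>t::real. poly (line_poly p e x) t = 0 \<longrightarrow> 0 \<le> t}"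

end

theory Submission
  imports Defs "HOL-Computational_Algebra.Fundamental_Theorem_Algebra"
begin

text \<open>
  Since \<open>K\<close> is its own bidual, it suffices to bound the bilinear forms on \<open>K\<^sup>*\<close> from below.
  For the augmented Hessian, a barrier satisfies \<open>- \<langle>g, z\<rangle> \<ge> \<parallel>z\<parallel>\<close> in the local norm for every
  recession direction \<open>z\<close>, so \<open>\<langle>u, H z\<rangle> \<ge> - \<parallel>u\<parallel> \<parallel>z\<parallel> \<ge> - \<langle>g, u\<rangle> \<langle>g, z\<rangle>\<close> by Cauchy--Schwarz.
  For a hyperbolic polynomial, \<open>p (x + \<i> w) \<noteq> 0\<close> for real \<open>x\<close> and \<open>w\<close> interior to the cone (Garding).
  Hence \<open>D\<^sub>u p / p\<close> maps \<open>y + s z\<close> with \<open>Im s > 0\<close> to the closed lower half plane, and its derivative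
  at \<open>s = 0\<close>, which is \<open>- \<langle>u, H z\<rangle>\<close>, is nonpositive.
\<close>

section \<open>Convex cones\<close>

text \<open>A point outside \<open>K\<close> is strictly separated from it by a hyperplane. Because
  \<open>K\<close> is closed under scaling, the normal \<open>a\<close> cannot be negative anywhere
  on \<open>K\<close>, so it is a dual vector violating the hypothesis at \<open>w\<close>.\<close>

lemma bipolar:
  assumes "convex_cone K" "closed K" "\<And>u. u \<in> dual_cone K \<Longrightarrow> 0 \<le> u \<bullet> w"
  shows "w \<in> K"
proof (rule ccontr)
  assume "w \<notin> K"
  then obtain a b where ab: "a \<bullet> w < b" "\<And>x. x \<in> K \<Longrightarrow> b < a \<bullet> x"
    using separating_hyperplane_closed_point[of K w] assms(1,2) by (auto simp: convex_cone_def)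
  have "0 \<in> K" using assms(1) by (rule convex_cone_contains_0)
  then have "b < 0" using ab(2)[of 0] by simp
  have "0 \<le> x \<bullet> a" if "x \<in> K" for x
  proof (rule ccontr)
    assume "\<not> 0 \<le> x \<bullet> a"
    then have neg: "a \<bullet> x < 0" by (simp add: inner_commute)
    \<comment> \<open>The factor makes the inner product with \<open>a\<close> exactly
      \<open>b\<close>, against the strict bound on \<open>K\<close>.\<close>
    then have "(b / (a \<bullet> x)) *\<^sub>R x \<in> K"
      using \<open>b < 0\<close> by (intro convex_cone_scaleR[OF assms(1)] that) (simp add: divide_nonpos_nonpos)
    from ab(2)[OF this] show False using neg by simp
  qed
  then have "a \<in> dual_cone K" by (simp add: dual_cone_def)
  then show False using assms(3)[of a] ab(1) \<open>b < 0\<close> by simp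
qed

text \<open>The translate of the interior by \<open>z\<close> is an open subset of
  \<open>C\<close>.\<close>

lemma interior_add_convex_cone:
  fixes C :: "'a::real_normed_vector set"
  assumes "convex_cone C" "y \<in> interior C" "z \<in> C"
  shows "y + z \<in> interior C"
proof -
  have "(+) z ` interior C \<subseteq> interior C"
  proof (rule interior_maximal)
    show "(+) z ` interior C \<subseteq> C"
      using assms interior_subset convex_cone_add by blast
    show "open ((+) z ` interior C)" by (rule open_translation) simp
  qed
  then show ?thesis using assms(2) by (auto simp: add.commute)
qed

lemma interior_convex_cone_scaleR:
  fixes C :: "'a::real_normed_vector set"
  assumes "convex_cone C" "y \<in> interior C" "0 < c"
  shows "c *\<^sub>R y \<in> interior C"
proof -
  have "(*\<^sub>R) c ` interior C \<subseteq> interior C"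
  proof (rule interior_maximal)
    show "(*\<^sub>R) c ` interior C \<subseteq> C"
      using interior_subset[of C] convex_cone_scaleR[OF assms(1) less_imp_le[OF assms(3)]] by blast
    show "open ((*\<^sub>R) c ` interior C)" using assms(3) by (intro open_scaling) auto
  qed
  then show ?thesis using assms(2) by auto
qed

lemma open_add_small_multiple:
  fixes w v :: "'a::real_normed_vector"
  assumes "open S" "w \<in> S"
  obtains \<epsilon> :: real where "\<epsilon> > 0" "w + \<epsilon> *\<^sub>R v \<in> S"
proof -
  have "((\<lambda>\<epsilon>. w + \<epsilon> *\<^sub>R v) \<longlongrightarrow> w + 0 *\<^sub>R v) (at_right 0)"
    by (intro tendsto_intros)
  then have "\<forall>\<^sub>F \<epsilon> in at_right 0. w + \<epsilon> *\<^sub>R v \<in> S"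
    using assms by (auto dest: topological_tendstoD)
  moreover have "\<forall>\<^sub>F \<epsilon>::real in at_right 0. \<epsilon> > 0"
    by (simp add: eventually_at_right_less)
  ultimately have "\<forall>\<^sub>F \<epsilon>::real in at_right 0. \<epsilon> > 0 \<and> w + \<epsilon> *\<^sub>R v \<in> S"
    by eventually_elim simp
  then show ?thesis
    using that eventually_happens'[OF trivial_limit_at_right_real] by blast
qed

section \<open>Self-concordant barriers\<close>

text \<open>The second difference \<open>D u v t\<close> is symmetric in \<open>u\<close> and
  \<open>v\<close>, and divided by \<open>t\<^sup>2\<close> it tends to
  \<open>u \<bullet> L v\<close>. One mean value step in direction \<open>u\<close> reduces it to a
  difference of values of \<open>G\<close>, which differentiability of \<open>G\<close> at
  \<open>x\<close> expands to first order.\<close>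

lemma second_derivative_symmetric:
  fixes f :: "'a::real_inner \<Rightarrow> real" and G :: "'a \<Rightarrow> 'a"
  assumes "open S" "x \<in> S" and G: "\<And>v. v \<in> S \<Longrightarrow> GDERIV f v :> G v"
    and L: "(G has_derivative L) (at x)"
  shows "u \<bullet> L v = v \<bullet> L u"
proof -
  define D where "D = (\<lambda>u v t. f (x + t *\<^sub>R u + t *\<^sub>R v) - f (x + t *\<^sub>R u) - f (x + t *\<^sub>R v) + f x)"
  have lim: "((\<lambda>t. D u v t / t\<^sup>2) \<longlongrightarrow> u \<bullet> L v) (at_right 0)" for u v
  proof (rule tendstoI)
    fix e :: real assume "0 < e"
    define M where "M = norm u + norm v + 1"
    have M: "M > 0" "norm u < M" "norm u + norm v < M" by (auto simp: M_def add_nonneg_pos)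
    \<comment> \<open>The two first-order remainders together contribute at most
      \<open>M * (2 * e' * t * M)\<close>, which this choice makes
      \<open>2 * e / 3 * t\<close>.\<close>
    define e' where "e' = e / (3 * M * M)"
    have "e' > 0" using \<open>0 < e\<close> M by (simp add: e'_def)
    then obtain d1 where d1: "d1 > 0"
      "\<And>y. norm (y - x) < d1 \<Longrightarrow> norm (G y - G x - L (y - x)) \<le> e' * norm (y - x)"
      using L unfolding has_derivative_at_alt by blast
    obtain d2 where d2: "d2 > 0" "ball x d2 \<subseteq> S"
      using assms(1,2) open_contains_ball by blast
    define d where "d = min d1 d2 / M"
    have "d > 0" using d1 d2 M by (simp add: d_def)
    have main: "dist (D u v t / t\<^sup>2) (u \<bullet> L v) < e" if t: "0 < t" "t < d" for t
    proof -
      have tM: "t * M < min d1 d2" using t M by (simp add: d_def field_simps)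
      have near: "norm (a *\<^sub>R u + b *\<^sub>R v) \<le> t * M" if "0 \<le> a" "a \<le> t" "0 \<le> b" "b \<le> t" for a b
      proof -
        have "norm (a *\<^sub>R u + b *\<^sub>R v) \<le> norm (a *\<^sub>R u) + norm (b *\<^sub>R v)"
          by (rule norm_triangle_ineq)
        also have "\<dots> \<le> t * norm u + t * norm v"
          using that by (auto intro!: add_mono mult_right_mono)
        also have "\<dots> = t * (norm u + norm v)" by (simp add: algebra_simps)
        also have "\<dots> \<le> t * M" using t M by (intro mult_left_mono) auto
        finally show ?thesis .
      qed
      have inS: "x + (a *\<^sub>R u + b *\<^sub>R v) \<in> S" if "0 \<le> a" "a \<le> t" "0 \<le> b" "b \<le> t" for a b
        using le_less_trans[OF near[OF that] tM]
        by (intro subsetD[OF d2(2)]) (simp add: dist_commute[of x] dist_norm[of _ x])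
      have err: "norm (G (x + (a *\<^sub>R u + b *\<^sub>R v)) - G x - L (a *\<^sub>R u + b *\<^sub>R v)) \<le> e' * (t * M)"
        if "0 \<le> a" "a \<le> t" "0 \<le> b" "b \<le> t" for a b
      proof -
        have "norm (G (x + (a *\<^sub>R u + b *\<^sub>R v)) - G x - L (a *\<^sub>R u + b *\<^sub>R v))
            \<le> e' * norm (a *\<^sub>R u + b *\<^sub>R v)"
          using d1(2)[of "x + (a *\<^sub>R u + b *\<^sub>R v)"] near[OF that] tM by simp
        also have "\<dots> \<le> e' * (t * M)" using near[OF that] \<open>e' > 0\<close> by (intro mult_left_mono) auto
        finally show ?thesis .
      qed
      have der: "((\<lambda>\<tau>. f (x + (\<tau> *\<^sub>R u + b *\<^sub>R v))) has_real_derivative u \<bullet> G (x + (\<tau> *\<^sub>R u + b *\<^sub>R v))) (at \<tau>)"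
        if "0 \<le> \<tau>" "\<tau> \<le> t" "0 \<le> b" "b \<le> t" for \<tau> b
      proof -
        have "(f has_derivative (\<lambda>h. h \<bullet> G (x + (\<tau> *\<^sub>R u + b *\<^sub>R v)))) (at (x + (\<tau> *\<^sub>R u + b *\<^sub>R v)))"
          using G[OF inS[OF that]] by (simp add: gderiv_def)
        then have "((\<lambda>\<tau>. f (x + (\<tau> *\<^sub>R u + b *\<^sub>R v))) has_derivative
            (\<lambda>h. (h *\<^sub>R u) \<bullet> G (x + (\<tau> *\<^sub>R u + b *\<^sub>R v)))) (at \<tau>)"
          by (rule has_derivative_compose[rotated]) (auto intro!: derivative_eq_intros)
        then show ?thesis by (simp add: has_field_derivative_def mult_commute_abs)
      qed
      \<comment> \<open>The increment of \<open>f\<close> in direction \<open>v\<close>, moved along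
        \<open>u\<close>; the second difference is then \<open>g t - g 0\<close>.\<close>
      define g where "g = (\<lambda>\<tau>. f (x + (\<tau> *\<^sub>R u + t *\<^sub>R v)) - f (x + (\<tau> *\<^sub>R u + 0 *\<^sub>R v)))"
      define g' where "g' = (\<lambda>\<tau>. u \<bullet> G (x + (\<tau> *\<^sub>R u + t *\<^sub>R v)) - u \<bullet> G (x + (\<tau> *\<^sub>R u + 0 *\<^sub>R v)))"
      have "\<exists>z. 0 < z \<and> z < t \<and> g t - g 0 = (t - 0) * g' z"
      proof (rule MVT2)
        show "(g has_real_derivative g' \<tau>) (at \<tau>)" if "0 \<le> \<tau>" "\<tau> \<le> t" for \<tau>
          unfolding g_def g'_def using that t by (intro DERIV_diff der) auto
      qed (use t in auto)
      then obtain z where z: "0 < z" "z < t" "g t - g 0 = t * g' z" by auto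
      have "D u v t = g t - g 0" by (simp add: D_def g_def algebra_simps)
      then have "D u v t / t\<^sup>2 = g' z / t" using z t by (simp add: power2_eq_square)
      moreover
      define r1 where "r1 = G (x + (z *\<^sub>R u + t *\<^sub>R v)) - G x - L (z *\<^sub>R u + t *\<^sub>R v)"
      define r2 where "r2 = G (x + (z *\<^sub>R u + 0 *\<^sub>R v)) - G x - L (z *\<^sub>R u + 0 *\<^sub>R v)"
      have "linear L" using L by (rule has_derivative_linear)
      then have "g' z = t * (u \<bullet> L v) + u \<bullet> (r1 - r2)"
        by (simp add: g'_def r1_def r2_def inner_diff_right inner_add_right linear_add linear_scale)
      ultimately have eq: "D u v t / t\<^sup>2 - u \<bullet> L v = (u \<bullet> (r1 - r2)) / t"
        using t by (simp add: field_simps)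
      have "\<bar>u \<bullet> (r1 - r2)\<bar> \<le> norm u * norm (r1 - r2)" by (rule Cauchy_Schwarz_ineq2)
      also have "\<dots> \<le> M * (e' * (t * M) + e' * (t * M))"
      proof (rule mult_mono)
        show "norm (r1 - r2) \<le> e' * (t * M) + e' * (t * M)"
          using err[of z t, folded r1_def] err[of z 0, folded r2_def] z t norm_triangle_ineq4[of r1 r2]
          by (simp add: r1_def[symmetric] r2_def[symmetric] mult_ac)
      qed (use M in auto)
      also have "\<dots> = t * (2 * e / 3)" using M by (simp add: e'_def field_simps)
      also have "\<dots> < t * e" using t \<open>0 < e\<close> by simp
      finally have "\<bar>u \<bullet> (r1 - r2)\<bar> / t < e" using t by (simp add: field_simps)
      then show ?thesis using eq t by (simp add: dist_real_def abs_divide)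
    qed
    show "\<forall>\<^sub>F t in at_right 0. dist (D u v t / t\<^sup>2) (u \<bullet> L v) < e"
      using \<open>d > 0\<close> main unfolding eventually_at_right_field by blast
  qed
  have "D u v = D v u" by (auto simp: D_def algebra_simps)
  then show ?thesis
    using tendsto_unique[OF _ lim[of u v] lim[of v u, folded \<open>D u v = D v u\<close>]] by simp
qed

lemma psd_matrix_Cauchy_Schwarz:
  fixes A :: "real ^ 'n ^ 'n"
  assumes sym: "\<And>u v. u \<bullet> (A *v v) = v \<bullet> (A *v u)"
    and psd: "\<And>v. 0 \<le> v \<bullet> (A *v v)"
  shows "(u \<bullet> (A *v v))\<^sup>2 \<le> (u \<bullet> (A *v u)) * (v \<bullet> (A *v v))"
proof -
  define a b c where "a = u \<bullet> (A *v u)" and "b = u \<bullet> (A *v v)" and "c = v \<bullet> (A *v v)"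
  have quad: "0 \<le> a * s\<^sup>2 + 2 * b * (s * t) + c * t\<^sup>2" for s t
    using psd[of "s *\<^sub>R u + t *\<^sub>R v"] sym[of v u]
    by (simp add: a_def b_def c_def matrix_vector_right_distrib matrix_vector_mult_scaleR
        inner_add_left inner_add_right power2_eq_square algebra_simps)
  have "b\<^sup>2 \<le> a * c"
  proof (cases "c = 0")
    case True
    have "c \<ge> 0" "a \<ge> 0" using psd by (auto simp: a_def c_def)
    show ?thesis
    proof (cases "b = 0")
      case False
      \<comment> \<open>With \<open>c = 0\<close> the form is affine in the second argument, which
        is chosen to produce the value \<open>a - (a + 1)\<close>.\<close>
      have "0 \<le> a * 1\<^sup>2 + 2 * b * (1 * (-(a + 1) / (2 * b))) + c * (-(a + 1) / (2 * b))\<^sup>2"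
        by (rule quad)
      also have "\<dots> = -1" using True False by (simp add: field_simps)
      finally show ?thesis by simp
    qed (simp add: True)
  next
    case False
    have "c > 0" using psd[of v] False by (simp add: c_def)
    \<comment> \<open>For first argument \<open>c\<close>, the form is minimal at second argument
      \<open>- b\<close>.\<close>
    have "0 \<le> a * c\<^sup>2 + 2 * b * (c * (- b)) + c * (- b)\<^sup>2" by (rule quad)
    also have "\<dots> = c * (a * c - b\<^sup>2)" by (simp add: power2_eq_square algebra_simps)
    finally show ?thesis using \<open>c > 0\<close> by (simp add: zero_le_mult_iff)
  qed
  then show ?thesis by (simp add: a_def b_def c_def)
qed

section \<open>Differential inequalities for a barrier restricted to a ray\<close>

lemma nonpos_if_derivative_ge_square:
  fixes g h :: "real \<Rightarrow> real"
  assumes g: "\<And>t. 0 \<le> t \<Longrightarrow> (g has_real_derivative h t) (at t)"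
    and nu: "\<nu> > 0" "\<And>t. 0 \<le> t \<Longrightarrow> (g t)\<^sup>2 \<le> \<nu> * h t"
    and "0 \<le> t0"
  shows "g t0 \<le> 0"
proof (rule ccontr)
  assume "\<not> g t0 \<le> 0"
  then have pos0: "g t0 > 0" by simp
  have h: "0 \<le> h t" if "0 \<le> t" for t
    using nu(2)[OF that] nu(1) by (smt (verit) zero_le_power2 zero_le_mult_iff)
  have pos: "g t > 0" if "t0 \<le> t" for t
    using DERIV_nonneg_imp_nondecreasing[OF that, of g] g h pos0 \<open>0 \<le> t0\<close>
    by (meson less_le_trans order_trans)
  \<comment> \<open>\<open>g' \<ge> g\<^sup>2 / \<nu>\<close> would force \<open>g\<close> to blow up in finite time\<close>
  define k where "k = (\<lambda>t. - inverse (g t) - t / \<nu>)"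
  have "k t0 \<le> k t" if "t0 \<le> t" for t
  proof (rule DERIV_nonneg_imp_nondecreasing[OF that])
    fix s assume s: "t0 \<le> s" "s \<le> t"
    have "(k has_real_derivative h s / (g s)\<^sup>2 - 1 / \<nu>) (at s)"
      unfolding k_def using pos[OF s(1)] s \<open>0 \<le> t0\<close> nu(1)
      by (auto intro!: derivative_eq_intros g simp: power2_eq_square field_simps)
    moreover have "1 / \<nu> \<le> h s / (g s)\<^sup>2"
      using nu s \<open>0 \<le> t0\<close> pos[OF s(1)] by (simp add: field_simps)
    ultimately show "\<exists>y. (k has_real_derivative y) (at s) \<and> 0 \<le> y"
      by (intro exI[of _ "h s / (g s)\<^sup>2 - 1 / \<nu>"]) auto
  qed
  \<comment> \<open>At this time the linear term of \<open>k\<close> has used up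
    \<open>inverse (g t0)\<close>, so \<open>k t0 \<le> k t\<close> leaves no room for a positive
    \<open>g t\<close>.\<close>
  moreover define t where "t = t0 + \<nu> * inverse (g t0)"
  have "t0 \<le> t" using nu pos0 by (simp add: t_def)
  ultimately have "k t0 \<le> k t" by blast
  then have "inverse (g t) \<le> 0"
    using nu by (simp add: k_def t_def add_divide_distrib)
  then show False using pos[OF \<open>t0 \<le> t\<close>] by (simp add: not_le)
qed

text \<open>The decay bound on \<open>h\<close> has integral at least \<open>sqrt (h 0)\<close> over
  the half-line. Since \<open>h\<close> is the derivative of \<open>g\<close> and \<open>g\<close>
  stays nonpositive by \<open>nonpos_if_derivative_ge_square\<close>, \<open>g\<close> must start at
  least that far below zero.\<close>

lemma self_concordant_ray:
  fixes g h h' :: "real \<Rightarrow> real"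
  assumes g: "\<And>t. 0 \<le> t \<Longrightarrow> (g has_real_derivative h t) (at t)"
    and h: "\<And>t. 0 \<le> t \<Longrightarrow> (h has_real_derivative h' t) (at t)"
    and hpos: "\<And>t. 0 \<le> t \<Longrightarrow> 0 < h t"
    and sc: "\<And>t. 0 \<le> t \<Longrightarrow> \<bar>h' t\<bar> \<le> 2 * h t powr (3 / 2)"
    and nu: "\<nu> > 0" "\<And>t. 0 \<le> t \<Longrightarrow> (g t)\<^sup>2 \<le> \<nu> * h t"
  shows "sqrt (h 0) \<le> - g 0"
proof -
  \<comment> \<open>self-concordance says that \<open>h powr (- 1 / 2)\<close> is 1-Lipschitz, so \<open>h\<close> decays at most quadratically\<close>
  define k where "k = (\<lambda>t. h t powr (- (1 / 2)))"
  have kpos: "k t > 0" if "0 \<le> t" for t using hpos[OF that] by (simp add: k_def)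
  have k_le: "k t \<le> k 0 + t" if "0 \<le> t" for t
  proof -
    have "0 - k 0 \<le> t - k t"
    proof (rule DERIV_nonneg_imp_nondecreasing[OF that])
      fix s :: real assume s: "0 \<le> s" "s \<le> t"
      have "(k has_real_derivative (- (1 / 2)) * h s powr (- (1 / 2) - 1) * h' s) (at s)"
        unfolding k_def using has_real_derivative_powr[OF hpos[OF s(1)]] h[OF s(1)]
        by (rule DERIV_chain2)
      then have "((\<lambda>s. s - k s) has_real_derivative 1 + h s powr (- (3 / 2)) * h' s / 2) (at s)"
        by (auto intro!: derivative_eq_intros)
      moreover have "\<bar>h s powr (- (3 / 2)) * h' s\<bar> \<le> 2"
      proof -
        have "\<bar>h s powr (- (3 / 2)) * h' s\<bar> \<le> h s powr (- (3 / 2)) * (2 * h s powr (3 / 2))"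
          using sc[OF s(1)] by (simp add: abs_mult mult_left_mono)
        also have "\<dots> = 2" using hpos[OF s(1)] by (simp add: powr_minus field_simps)
        finally show ?thesis .
      qed
      ultimately show "\<exists>y. ((\<lambda>s. s - k s) has_real_derivative y) (at s) \<and> 0 \<le> y"
        by (intro exI[of _ "1 + h s powr (- (3 / 2)) * h' s / 2"]) (auto simp: abs_le_iff)
    qed
    then show ?thesis by simp
  qed
  have h_eq: "h t = inverse ((k t)\<^sup>2)" if "0 \<le> t" for t
    using hpos[OF that] by (simp add: k_def powr_minus powr_half_sqrt power_inverse)
  have bound: "g 0 + inverse (k 0) \<le> inverse (k 0 + t)" if "0 \<le> t" for t
  proof -
    \<comment> \<open>Monotonicity of \<open>g s + inverse (k 0 + s)\<close> replaces integrating
      \<open>inverse ((k 0 + s)\<^sup>2) \<le> h s\<close>.\<close>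
    have "g 0 + inverse (k 0 + 0) \<le> g t + inverse (k 0 + t)"
    proof (rule DERIV_nonneg_imp_nondecreasing[OF that])
      fix s :: real assume s: "0 \<le> s" "s \<le> t"
      have "((\<lambda>s. g s + inverse (k 0 + s)) has_real_derivative h s - inverse ((k 0 + s)\<^sup>2)) (at s)"
        using kpos[of 0] s
        by (auto intro!: derivative_eq_intros g simp: power2_eq_square)
      moreover have "inverse ((k 0 + s)\<^sup>2) \<le> h s"
        unfolding h_eq[OF s(1)] using k_le[OF s(1)] kpos[OF s(1)]
        by (intro le_imp_inverse_le power_mono) auto
      ultimately show "\<exists>y. ((\<lambda>s. g s + inverse (k 0 + s)) has_real_derivative y) (at s) \<and> 0 \<le> y"
        by (intro exI[of _ "h s - inverse ((k 0 + s)\<^sup>2)"]) auto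
    qed
    moreover have "g t \<le> 0"
      using g nu that by (rule nonpos_if_derivative_ge_square)
    ultimately show ?thesis by simp
  qed
  have "g 0 + inverse (k 0) \<le> 0"
  proof (rule tendsto_lowerbound)
    show "((\<lambda>t. inverse (k 0 + t)) \<longlongrightarrow> 0) at_top"
      by (intro tendsto_inverse_0_at_top filterlim_tendsto_add_at_top[OF tendsto_const] filterlim_ident)
    show "\<forall>\<^sub>F t in at_top. g 0 + inverse (k 0) \<le> inverse (k 0 + t)"
      using eventually_ge_at_top[of 0] by eventually_elim (rule bound)
  qed simp
  moreover have "inverse (k 0) = sqrt (h 0)"
    using hpos[of 0] by (simp add: k_def powr_minus powr_half_sqrt)
  ultimately show ?thesis by simp
qed

section \<open>Gradient and Hessian inequalities from the barrier axioms\<close>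

lemma has_derivative_hessian:
  assumes "gradient f differentiable (at x)"
  shows "(gradient f has_derivative (*v) (hessian f x)) (at x)"
  using assms unfolding hessian_def jacobian_works .

lemma augmented_hessian_mult:
  "u \<bullet> (augmented_hessian f y *v z) =
     u \<bullet> (hessian f y *v z) + (u \<bullet> gradient f y) * (gradient f y \<bullet> z)"
proof -
  have "((columnvector (gradient f y) :: real ^ 1 ^ 'a) ** rowvector (gradient f y)) *v z
      = (gradient f y \<bullet> z) *\<^sub>R gradient f y"
    by (simp add: vec_eq_iff matrix_vector_mult_def matrix_matrix_mult_def columnvector_def
        rowvector_def inner_vec_def sum_distrib_left sum_distrib_right mult_ac)
  then show ?thesis
    by (simp add: augmented_hessian_def matrix_vector_mult_add_rdistrib inner_add_right)
qed

context
  fixes C :: "(real ^ 'm) set" and f :: "real ^ 'm \<Rightarrow> real"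
  assumes scb: "self_concordant_barrier C f"
begin

lemma scb_hessian_symmetric:
  assumes "y \<in> interior C"
  shows "u \<bullet> (hessian f y *v v) = v \<bullet> (hessian f y *v u)"
proof -
  have "GDERIV f v :> gradient f v" if "v \<in> interior C" for v
    using scb that by (intro GDERIV_gradient)
      (auto simp: self_concordant_barrier_def three_times_differentiable_on_def)
  moreover have "(gradient f has_derivative (*v) (hessian f y)) (at y)"
    using scb assms by (intro has_derivative_hessian)
      (auto simp: self_concordant_barrier_def three_times_differentiable_on_def)
  ultimately show ?thesis
    using second_derivative_symmetric[OF open_interior assms] by blast
qed

lemma scb_hessian_pos: "0 < h \<bullet> (hessian f y *v h)" if "y \<in> interior C" "h \<noteq> 0"
  using scb that by (auto simp: self_concordant_barrier_def)

lemma scb_hessian_Cauchy_Schwarz: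
  assumes "y \<in> interior C"
  shows "(u \<bullet> (hessian f y *v v))\<^sup>2 \<le> (u \<bullet> (hessian f y *v u)) * (v \<bullet> (hessian f y *v v))"
proof (rule psd_matrix_Cauchy_Schwarz)
  show "0 \<le> v \<bullet> (hessian f y *v v)" for v
    using scb_hessian_pos[OF assms, of v] by (cases "v = 0") auto
qed (rule scb_hessian_symmetric[OF assms])

text \<open>Frees the finite barrier parameter from the inverse Hessian: Cauchy-Schwarz in the
  Hessian form, applied to \<open>u\<close> and the Newton direction
  \<open>matrix_inv (hessian f y) *v gradient f y\<close>.\<close>

lemma scb_gradient_bound:
  obtains \<nu> where "\<nu> > 0"
    "\<And>y u. y \<in> interior C \<Longrightarrow> (u \<bullet> gradient f y)\<^sup>2 \<le> \<nu> * (u \<bullet> (hessian f y *v u))"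
proof -
  from scb obtain M where
    M: "\<And>x. x \<in> interior C \<Longrightarrow> gradient f x \<bullet> (matrix_inv (hessian f x) *v gradient f x) \<le> M"
    unfolding self_concordant_barrier_def bdd_above_def by blast
  \<comment> \<open>Taking \<open>max 1 M\<close> guarantees the positive constant that the ray
    estimates ask for.\<close>
  have "(u \<bullet> gradient f y)\<^sup>2 \<le> max 1 M * (u \<bullet> (hessian f y *v u))" if y: "y \<in> interior C" for y u
  proof -
    let ?H = "hessian f y" and ?g = "gradient f y"
    have "v = 0" if "?H *v v = 0" for v
      using scb_hessian_pos[OF y, of v] that by auto
    then have "invertible ?H"
      by (simp add: invertible_left_inverse matrix_left_invertible_ker)
    then have "?H ** matrix_inv ?H = mat 1"
      unfolding invertible_def matrix_inv_def by (rule someI2_ex) simp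
    then have g: "?H *v (matrix_inv ?H *v ?g) = ?g" by (simp add: matrix_vector_mul_assoc)
    have "(u \<bullet> ?g)\<^sup>2 \<le> (u \<bullet> (?H *v u)) * (?g \<bullet> (matrix_inv ?H *v ?g))"
      using scb_hessian_Cauchy_Schwarz[OF y, of u "matrix_inv ?H *v ?g"]
      by (simp add: g inner_commute)
    also have "\<dots> \<le> (u \<bullet> (?H *v u)) * max 1 M"
      using M[OF y] scb_hessian_pos[OF y, of u] by (intro mult_left_mono) (cases "u = 0"; auto)+
    finally show ?thesis by (simp add: mult.commute)
  qed
  then show ?thesis by (intro that[of "max 1 M"]) auto
qed

text \<open>The ray from \<open>y\<close> in direction \<open>z\<close> never leaves the interior,
  so \<open>self_concordant_ray\<close> applies to the first three derivatives \<open>g\<close>,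
  \<open>h\<close>, \<open>h'\<close> of \<open>f\<close> along it. The case \<open>z = 0\<close> is
  separate because \<open>h\<close> vanishes there.\<close>

lemma scb_recession_direction:
  assumes y: "y \<in> interior C" and z: "z \<in> C"
  shows "sqrt (z \<bullet> (hessian f y *v z)) \<le> - (z \<bullet> gradient f y)"
proof (cases "z = 0")
  case False
  have cone: "convex_cone C" using scb by (simp add: self_concordant_barrier_def)
  have ray: "y + t *\<^sub>R z \<in> interior C" if "0 \<le> t" for t
    using interior_add_convex_cone[OF cone y convex_cone_scaleR[OF cone that z]] .
  have diff: "gradient f differentiable (at v)" "hessian f differentiable (at v)"
    if "v \<in> interior C" for v
    using scb that by (auto simp: self_concordant_barrier_def three_times_differentiable_on_def)
  obtain \<nu> where nu: "\<nu> > 0"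
    "\<And>y u. y \<in> interior C \<Longrightarrow> (u \<bullet> gradient f y)\<^sup>2 \<le> \<nu> * (u \<bullet> (hessian f y *v u))"
    using scb_gradient_bound by blast
  define g where "g = (\<lambda>t. z \<bullet> gradient f (y + t *\<^sub>R z))"
  define h where "h = (\<lambda>t. z \<bullet> (hessian f (y + t *\<^sub>R z) *v z))"
  define h' where "h' = (\<lambda>t. z \<bullet> (frechet_derivative (hessian f) (at (y + t *\<^sub>R z)) z *v z))"
  \<comment> \<open>Composing the derivative of the matrix-valued Hessian with this functional
    yields the third directional derivative.\<close>
  have bl: "bounded_linear (\<lambda>A :: real ^ 'm ^ 'm. z \<bullet> (A *v z))"
  proof (rule linear_conv_bounded_linear[THEN iffD1])
    show "linear (\<lambda>A :: real ^ 'm ^ 'm. z \<bullet> (A *v z))"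
      by (auto intro!: linearI simp: matrix_vector_mult_add_rdistrib inner_add_right
          scaleR_matrix_vector_assoc[symmetric])
  qed
  have "sqrt (h 0) \<le> - g 0"
  proof (rule self_concordant_ray)
    fix t :: real assume t: "0 \<le> t"
    have F1: "(gradient f has_derivative (*v) (hessian f (y + t *\<^sub>R z))) (at (y + t *\<^sub>R z))"
      using has_derivative_hessian diff ray t by blast
    have "(g has_derivative (\<lambda>r. z \<bullet> (hessian f (y + t *\<^sub>R z) *v (r *\<^sub>R z)))) (at t)"
      unfolding g_def
      by (intro has_derivative_inner_right has_derivative_compose[where f = "\<lambda>t. y + t *\<^sub>R z" and g = "gradient f", OF _ F1])
         (auto intro!: derivative_eq_intros)
    then show "(g has_real_derivative h t) (at t)"
      by (simp add: has_field_derivative_def h_def matrix_vector_mult_scaleR mult_commute_abs)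
    have F: "(hessian f has_derivative frechet_derivative (hessian f) (at (y + t *\<^sub>R z))) (at (y + t *\<^sub>R z))"
      using diff(2)[OF ray[OF t]] by (simp add: frechet_derivative_works)
    then have lin: "linear (frechet_derivative (hessian f) (at (y + t *\<^sub>R z)))"
      by (rule has_derivative_linear)
    have "((\<lambda>t. hessian f (y + t *\<^sub>R z)) has_derivative
        (\<lambda>r. frechet_derivative (hessian f) (at (y + t *\<^sub>R z)) (r *\<^sub>R z))) (at t)"
      by (rule has_derivative_compose[where f = "\<lambda>t. y + t *\<^sub>R z" and g = "hessian f", OF _ F]) (auto intro!: derivative_eq_intros)
    from bounded_linear.has_derivative[OF bl this] show "(h has_real_derivative h' t) (at t)"
      by (simp add: has_field_derivative_def h_def h'_def linear_scale[OF lin]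
          scaleR_matrix_vector_assoc[symmetric] mult_commute_abs)
    show "0 < h t" using scb_hessian_pos[OF ray[OF t] False] by (simp add: h_def)
    show "\<bar>h' t\<bar> \<le> 2 * h t powr (3 / 2)"
      using scb ray[OF t] by (simp add: self_concordant_barrier_def h_def h'_def)
    show "(g t)\<^sup>2 \<le> \<nu> * h t" using nu(2)[OF ray[OF t]] by (simp add: g_def h_def)
  qed (fact nu(1))
  then show ?thesis by (simp add: g_def h_def)
qed simp

lemma scb_augmented_hessian_nonneg:
  assumes y: "y \<in> interior C" and "u \<in> C" "z \<in> C"
  shows "0 \<le> u \<bullet> (augmented_hessian f y *v z)"
proof -
  let ?H = "hessian f y" and ?g = "gradient f y"
  have nn: "0 \<le> v \<bullet> (?H *v v)" for v
    using scb_hessian_pos[OF y, of v] by (cases "v = 0") auto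
  have "\<bar>u \<bullet> (?H *v z)\<bar> \<le> sqrt (u \<bullet> (?H *v u)) * sqrt (z \<bullet> (?H *v z))"
    using scb_hessian_Cauchy_Schwarz[OF y, of u z]
    by (metis real_sqrt_abs real_sqrt_le_mono real_sqrt_mult)
  \<comment> \<open>The signs cancel, and the bound is the contribution of the rank-one term of the
    augmented Hessian.\<close>
  also have "\<dots> \<le> (- (u \<bullet> ?g)) * (- (z \<bullet> ?g))"
    using scb_recession_direction[OF y \<open>u \<in> C\<close>] scb_recession_direction[OF y \<open>z \<in> C\<close>]
      real_sqrt_ge_zero[OF nn[of u]] real_sqrt_ge_zero[OF nn[of z]]
    by (intro mult_mono) linarith+
  finally show ?thesis by (simp add: augmented_hessian_mult inner_commute)
qed

end

section \<open>Complex polynomials\<close>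

text \<open>Factorization into linear factors, recast as an induction that adds one root at a
  time.\<close>

lemma complex_poly_induct [consumes 1, case_names const root]:
  fixes q :: "complex poly"
  assumes "q \<noteq> 0" and const: "\<And>c. c \<noteq> 0 \<Longrightarrow> P [:c:]"
    and root: "\<And>r q. q \<noteq> 0 \<Longrightarrow> P q \<Longrightarrow> P ([:- r, 1:] * q)"
  shows "P q"
proof -
  obtain A where A: "q = smult (lead_coeff q) (\<Prod>x\<in>#A. [:- x, 1:])"
    using alg_closed_imp_factorization[OF \<open>q \<noteq> 0\<close>] by blast
  \<comment> \<open>Nonvanishing is carried along because \<open>root\<close> demands it of the
    smaller polynomial.\<close>
  have "P (smult c (\<Prod>x\<in>#A. [:- x, 1:])) \<and> smult c (\<Prod>x\<in>#A. [:- x, 1:]) \<noteq> 0"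
    if "c \<noteq> 0" for c
  proof (induction A)
    case empty
    then show ?case using const[OF that] that by simp
  next
    case (add r A)
    have "smult c (\<Prod>x\<in>#add_mset r A. [:- x, 1:]) = [:- r, 1:] * smult c (\<Prod>x\<in>#A. [:- x, 1:])"
      by (simp only: image_mset_add_mset prod_mset.add_mset mult_smult_right)
    then show ?case using root[of "smult c (\<Prod>x\<in>#A. [:- x, 1:])" r] add
      by (metis mult_eq_0_iff pCons_eq_0_iff zero_neq_one)
  qed
  then show ?thesis using A \<open>q \<noteq> 0\<close> by (metis leading_coeff_0_iff)
qed

text \<open>Each linear factor contributes at least \<open>\<delta>\<close> at \<open>s\<close>. The
  bound depends on the leading coefficient, the degree and \<open>\<delta>\<close> alone, so it
  survives a limit of polynomials that share them.\<close>

lemma cmod_poly_ge_if_roots_far: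
  fixes q :: "complex poly"
  assumes "q \<noteq> 0" "0 \<le> \<delta>" "\<And>r. poly q r = 0 \<Longrightarrow> \<delta> \<le> cmod (s - r)"
  shows "cmod (lead_coeff q) * \<delta> ^ degree q \<le> cmod (poly q s)"
  using assms(1,3)
proof (induction q rule: complex_poly_induct)
  case (root r q)
  have "cmod (lead_coeff q) * \<delta> ^ degree q \<le> cmod (poly q s)"
    using root.prems by (intro root.IH) simp
  moreover have "\<delta> \<le> cmod (s - r)" using root.prems[of r] by simp
  ultimately have "\<delta> * (cmod (lead_coeff q) * \<delta> ^ degree q) \<le> cmod (s - r) * cmod (poly q s)"
    using \<open>0 \<le> \<delta>\<close> by (intro mult_mono) auto
  moreover have "degree ([:- r, 1:] * q) = Suc (degree q)"
    using root.hyps by (subst degree_mult_eq) auto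
  moreover have "poly ([:- r, 1:] * q) s = (s - r) * poly q s"
    by (simp only: poly_mult) (simp add: algebra_simps)
  moreover have "lead_coeff ([:- r, 1:] * q) = lead_coeff q"
    by (simp only: lead_coeff_mult) simp
  ultimately show ?case
    by (simp only: norm_mult power_Suc mult_ac)
qed simp

text \<open>The quotient is the logarithmic derivative of \<open>q\<close> at 0, that is, the sum of
  \<open>- 1 / r\<close> over the roots with multiplicity, and \<open>- 1 / r\<close> lies in the
  same half plane as \<open>r\<close>.\<close>

lemma Im_log_derivative_nonpos:
  fixes q :: "complex poly"
  assumes "q \<noteq> 0" "\<And>r. poly q r = 0 \<Longrightarrow> Im r < 0"
  shows "Im (coeff q 1 / coeff q 0) \<le> 0"
  using assms
proof (induction q rule: complex_poly_induct)
  case (root r q)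
  have IH: "Im (coeff q 1 / coeff q 0) \<le> 0"
    using root.prems by (intro root.IH) simp
  have "poly q 0 \<noteq> 0" using root.prems[of 0] by auto
  then have q0: "coeff q 0 \<noteq> 0" by (simp add: poly_0_coeff_0)
  have r: "Im r < 0" using root.prems[of r] by simp
  then have "r \<noteq> 0" by auto
  have c0: "coeff ([:- r, 1:] * q) 0 = - r * coeff q 0" by simp
  have c1: "coeff ([:- r, 1:] * q) 1 = coeff q 0 - r * coeff q 1" by simp
  have "coeff ([:- r, 1:] * q) 1 / coeff ([:- r, 1:] * q) 0 = coeff q 1 / coeff q 0 - 1 / r"
    unfolding c0 c1 using q0 \<open>r \<noteq> 0\<close> by (simp add: field_simps)
  moreover have "0 \<le> Im (1 / r)"
    using r by (simp add: Im_divide divide_nonpos_nonneg)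
  ultimately show ?case using IH by simp
qed simp

text \<open>Degree bounds replace exact degrees because the linear factors
  \<open>[:a i, b i:]\<close> below may be constant.\<close>

lemma coeff_mult_degree_le:
  fixes p q :: "'a::comm_semiring_0 poly"
  assumes "degree p \<le> m" "degree q \<le> n"
  shows "coeff (p * q) (m + n) = coeff p m * coeff q n"
proof (cases "degree p = m \<and> degree q = n")
  case True
  then show ?thesis using coeff_mult_degree_sum[of p q] by auto
next
  case False
  then have "degree (p * q) < m + n" "degree p < m \<or> degree q < n"
    using assms degree_mult_le[of p q] by linarith+
  then show ?thesis by (auto simp: coeff_eq_0)
qed

lemma linear_powers_top_coeff:
  fixes a b :: "'i \<Rightarrow> 'a::comm_semiring_1"
  assumes "finite S"
  shows "degree (\<Prod>i\<in>S. [:a i, b i:] ^ n i) \<le> (\<Sum>i\<in>S. n i) \<and>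
    coeff (\<Prod>i\<in>S. [:a i, b i:] ^ n i) (\<Sum>i\<in>S. n i) = (\<Prod>i\<in>S. b i ^ n i)"
  using assms
proof (induction S)
  case (insert x S)
  have pow: "degree ([:a x, b x:] ^ k) \<le> k \<and> coeff ([:a x, b x:] ^ k) k = b x ^ k" for k
  proof (induction k)
    case (Suc k)
    have d: "degree [:a x, b x:] \<le> 1" by simp
    have "degree ([:a x, b x:] * [:a x, b x:] ^ k) \<le> 1 + k"
      using d Suc degree_mult_le[of "[:a x, b x:]" "[:a x, b x:] ^ k"] by linarith
    moreover have "coeff ([:a x, b x:] * [:a x, b x:] ^ k) (1 + k) = b x * b x ^ k"
      using coeff_mult_degree_le[OF d, of "[:a x, b x:] ^ k" k] Suc by simp
    ultimately show ?case by simp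
  qed simp
  have "degree ([:a x, b x:] ^ n x * (\<Prod>i\<in>S. [:a i, b i:] ^ n i)) \<le> n x + (\<Sum>i\<in>S. n i)"
    using insert.IH pow[of "n x"] degree_mult_le[of "[:a x, b x:] ^ n x" "\<Prod>i\<in>S. [:a i, b i:] ^ n i"]
    by linarith
  then show ?case
    using insert coeff_mult_degree_le[of "[:a x, b x:] ^ n x" "n x" "\<Prod>i\<in>S. [:a i, b i:] ^ n i" "\<Sum>i\<in>S. n i"] pow
    by simp
qed simp

section \<open>Hyperbolic polynomials\<close>

definition complex_eval :: "'m::finite mpoly \<Rightarrow> ('m \<Rightarrow> complex) \<Rightarrow> complex" where
  "complex_eval p x =
     (\<Sum>a\<in>Poly_Mapping.keys p. of_real (Poly_Mapping.lookup p a) * (\<Prod>i\<in>UNIV. x i ^ Poly_Mapping.lookup a i))"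

text \<open>The restriction of \<open>p\<close> to the complex line through \<open>x\<close> with
  direction \<open>v\<close>. The base point enters with a plus sign, unlike in
  \<open>line_poly\<close>.\<close>

definition complex_line :: "'m::finite mpoly \<Rightarrow> ('m \<Rightarrow> complex) \<Rightarrow> ('m \<Rightarrow> complex) \<Rightarrow> complex poly" where
  "complex_line p x v =
     (\<Sum>a\<in>Poly_Mapping.keys p. smult (of_real (Poly_Mapping.lookup p a))
        (\<Prod>i\<in>UNIV. [:x i, v i:] ^ Poly_Mapping.lookup a i))"

lemma poly_complex_line: "poly (complex_line p x v) t = complex_eval p (\<lambda>i. x i + t * v i)"
  by (simp add: complex_line_def complex_eval_def poly_sum poly_prod)

lemma continuous_on_complex_eval [continuous_intros]:
  fixes x :: "'a::topological_space \<Rightarrow> 'm::finite \<Rightarrow> complex"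
  assumes "\<And>i. continuous_on S (\<lambda>s. x s i)"
  shows "continuous_on S (\<lambda>s. complex_eval p (x s))"
  unfolding complex_eval_def by (intro continuous_intros assms)

lemma complex_eval_of_real:
  "complex_eval p (\<lambda>i. of_real (x $ i)) = of_real (mpoly_eval p x)"
  by (simp add: complex_eval_def mpoly_eval_def)

text \<open>One exponent \<open>d\<close> serves for scaling and for the degree in the line
  parameter. The coefficient at \<open>d\<close> depends only on the direction, which keeps the
  roots under control while the base point moves.\<close>

lemma homogeneousE:
  fixes p :: "'m::finite mpoly"
  assumes "homogeneous p"
  obtains d where "\<And>c x. complex_eval p (\<lambda>i. c * x i) = c ^ d * complex_eval p x"
    "\<And>x v. degree (complex_line p x v) \<le> d"
    "\<And>x v. coeff (complex_line p x v) d = complex_eval p v"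
proof -
  obtain d where d: "\<And>a. a \<in> Poly_Mapping.keys p \<Longrightarrow> (\<Sum>i\<in>UNIV. Poly_Mapping.lookup a i) = d"
    using assms unfolding homogeneous_def by blast
  note top = linear_powers_top_coeff[OF finite_class.finite_UNIV]
  show ?thesis
  proof (rule that[of d])
    show "complex_eval p (\<lambda>i. c * x i) = c ^ d * complex_eval p x" for c x
      using d by (auto simp: complex_eval_def sum_distrib_left power_mult_distrib prod.distrib
          mult_ac power_sum[symmetric] intro!: sum.cong)
    show "degree (complex_line p x v) \<le> d" for x v
      unfolding complex_line_def
    proof (intro degree_sum_le)
      fix a assume "a \<in> Poly_Mapping.keys p"
      then show "degree (smult (complex_of_real (Poly_Mapping.lookup p a))
          (\<Prod>i\<in>UNIV. [:x i, v i:] ^ Poly_Mapping.lookup a i)) \<le> d"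
        using top[of x v "Poly_Mapping.lookup a"] d by (auto intro: order_trans[OF degree_smult_le])
    qed simp
    show "coeff (complex_line p x v) d = complex_eval p v" for x v
      unfolding complex_line_def complex_eval_def coeff_sum
    proof (intro sum.cong refl)
      fix a assume "a \<in> Poly_Mapping.keys p"
      then show "coeff (smult (complex_of_real (Poly_Mapping.lookup p a))
          (\<Prod>i\<in>UNIV. [:x i, v i:] ^ Poly_Mapping.lookup a i)) d
        = complex_of_real (Poly_Mapping.lookup p a) * (\<Prod>i\<in>UNIV. v i ^ Poly_Mapping.lookup a i)"
        using top[of x v "Poly_Mapping.lookup a"] d by simp
    qed
  qed
qed

lemma map_poly_of_real_mult:
  "map_poly complex_of_real (p * q) = map_poly complex_of_real p * map_poly complex_of_real q"
  by (intro poly_eqI) (simp add: coeff_map_poly coeff_mult)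

lemma map_poly_of_real_prod:
  "map_poly complex_of_real (\<Prod>i\<in>S. f i) = (\<Prod>i\<in>S. map_poly complex_of_real (f i))"
  by (induction S rule: infinite_finite_induct) (simp_all add: map_poly_of_real_mult)

lemma map_poly_of_real_power:
  "map_poly complex_of_real (p ^ n) = map_poly complex_of_real p ^ n"
  by (induction n) (simp_all add: map_poly_of_real_mult)

lemma map_poly_line_poly:
  "map_poly complex_of_real (line_poly p e x) = complex_line p (\<lambda>i. of_real (- x $ i)) (\<lambda>i. of_real (e $ i))"
proof -
  have sum: "map_poly complex_of_real (sum f S) = (\<Sum>i\<in>S. map_poly complex_of_real (f i))"
    for f :: "('a \<Rightarrow>\<^sub>0 nat) \<Rightarrow> real poly" and S
    by (intro poly_eqI) (simp add: coeff_map_poly coeff_sum)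
  show ?thesis
    by (simp add: line_poly_def complex_line_def sum map_poly_smult map_poly_of_real_prod
        map_poly_of_real_power map_poly_pCons)
qed

lemma poly_line_poly_complex:
  "poly (map_poly complex_of_real (line_poly p e x)) t
     = complex_eval p (\<lambda>i. t * of_real (e $ i) - of_real (x $ i))"
  by (simp add: map_poly_line_poly poly_complex_line)

text \<open>
  Roots in \<open>s\<close> are followed along \<open>b \<mapsto> \<i> \<alpha> e + s w + b x\<close>. At \<open>b = 0\<close> they lie in the open lower
  half plane, and they never become real since \<open>p\<close> is hyperbolic; at the first \<open>b\<close> with a root \<open>s'\<close>
  in the upper half plane, all roots for smaller \<open>b\<close> would be at distance at least \<open>Im s'\<close> from \<open>s'\<close>.
\<close>

lemma hyperbolic_no_root_half_plane:
  fixes p :: "'m::finite mpoly" and e w x :: "real ^ 'm" and \<alpha> :: real and s :: complex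
  assumes hyp: "hyperbolic p e"
    and w: "\<And>t. poly (line_poly p e w) t = 0 \<Longrightarrow> 0 < t"
    and "0 < \<alpha>" "0 \<le> Im s"
  shows "complex_eval p (\<lambda>i. \<i> * \<alpha> * e $ i + s * w $ i + x $ i) \<noteq> 0"
proof
  assume root: "complex_eval p (\<lambda>i. \<i> * \<alpha> * e $ i + s * w $ i + x $ i) = 0"
  obtain d where hom: "\<And>c x. complex_eval p (\<lambda>i. c * x i) = c ^ d * complex_eval p x"
    and deg: "\<And>x v. degree (complex_line p x v) \<le> d"
    and top: "\<And>x v. coeff (complex_line p x v) d = complex_eval p v"
    using hyp homogeneousE[of p] unfolding hyperbolic_def by blast
  have real: "t \<in> \<real>" if "complex_eval p (\<lambda>i. t * e $ i - z $ i) = 0" for t :: complex and z :: "real ^ 'm"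
    using hyp that by (auto simp: hyperbolic_def poly_line_poly_complex)
  have hom0: "complex_eval p (\<lambda>i. c * y i) = 0 \<longleftrightarrow> complex_eval p y = 0" if "c \<noteq> 0" for c y
    using that by (simp add: hom)
  define F where "F = (\<lambda>(b::real, s::complex). complex_eval p (\<lambda>i. \<i> * \<alpha> * e $ i + s * w $ i + b * x $ i))"
  have e0: "complex_eval p (\<lambda>i. of_real (e $ i)) \<noteq> 0"
    using hyp by (simp add: complex_eval_of_real hyperbolic_def)
  \<comment> \<open>By homogeneity, a zero of \<open>p\<close> at \<open>w\<close> would make 0 a
    root of \<open>line_poly p e w\<close>, whose roots are strictly positive.\<close>
  have w0: "complex_eval p (\<lambda>i. of_real (w $ i)) \<noteq> 0"
  proof
    assume "complex_eval p (\<lambda>i. of_real (w $ i)) = 0"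
    then have "complex_eval p (\<lambda>i. (-1) * of_real (w $ i)) = 0" by (simp only: hom) simp
    then have "complex_eval p (\<lambda>i. of_real ((- w) $ i)) = 0" by simp
    then have "mpoly_eval p (- w) = 0"
      by (simp only: complex_eval_of_real of_real_eq_0_iff)
    then have "poly (line_poly p e w) 0 = 0" by (simp add: poly_line_poly)
    from w[OF this] show False by simp
  qed
  \<comment> \<open>For real \<open>r\<close> the argument is \<open>\<i> * \<alpha> * e\<close>
    minus a real vector, so a zero would give hyperbolicity a nonreal root.\<close>
  have noreal: "F (b, of_real r) \<noteq> 0" for b r
  proof
    assume "F (b, of_real r) = 0"
    then have "\<i> * of_real \<alpha> \<in> \<real>"
      by (intro real[of _ "- (r *\<^sub>R w + b *\<^sub>R x)"]) (simp add: F_def algebra_simps)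
    then show False using \<open>0 < \<alpha>\<close> by (simp add: complex_is_Real_iff)
  qed
  have start: "F (0, s) \<noteq> 0" if "0 \<le> Im s" for s
  proof
    assume F0: "F (0, s) = 0"
    show False
    proof (cases "s = 0")
      case True
      then have "complex_eval p (\<lambda>i. (\<i> * \<alpha>) * e $ i) = 0" using F0 by (simp add: F_def)
      then show False using hom0[of "\<i> * \<alpha>" "\<lambda>i. of_real (e $ i)"] e0 \<open>0 < \<alpha>\<close> by simp
    next
      case False
      \<comment> \<open>Dividing \<open>\<i> * \<alpha> * e + s * w\<close> by \<open>- s\<close>
        gives \<open>t * e - w\<close>. Hence \<open>t\<close> is real and positive, which forces
        \<open>s\<close> onto the negative imaginary axis.\<close>
      define t where "t = - (\<i> * \<alpha> / s)"
      have "complex_eval p (\<lambda>i. (- s) * (t * e $ i - w $ i)) = 0"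
        using F0 False by (simp add: F_def t_def algebra_simps)
      then have t0: "complex_eval p (\<lambda>i. t * e $ i - w $ i) = 0"
        using hom0[of "- s"] False by simp
      then obtain r where r: "t = of_real r" using real[of t w] by (auto elim: Reals_cases)
      have "poly (line_poly p e w) r = 0"
      proof -
        have "complex_eval p (\<lambda>i. of_real ((r *\<^sub>R e - w) $ i)) = 0"
          using t0 by (simp add: r)
        then show ?thesis by (simp only: complex_eval_of_real of_real_eq_0_iff poly_line_poly)
      qed
      then have "0 < r" by (rule w)
      have "s = - (\<i> * \<alpha> / r)" using r False \<open>0 < r\<close> by (simp add: t_def field_simps)
      then have "Im s = - (\<alpha> / r)" by simp
      moreover have "0 < \<alpha> / r" using \<open>0 < r\<close> \<open>0 < \<alpha>\<close> by simp
      ultimately show False using \<open>0 \<le> Im s\<close> by simp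
    qed
  qed
  \<comment> \<open>This is \<open>F\<close> seen from infinity:
    \<open>F (b, s) = s ^ d * \<Psi> (1 / s, b / s)\<close>. Its value at the origin is
    \<open>p\<close> at \<open>w\<close>, so large \<open>s\<close> cannot be roots, uniformly for
    \<open>b\<close> in the unit interval.\<close>
  define \<Psi> where "\<Psi> = (\<lambda>(u :: complex, v :: complex).
    complex_eval p (\<lambda>i. w $ i + u * (\<i> * \<alpha> * e $ i) + v * x $ i))"
  have "continuous_on UNIV \<Psi>"
    unfolding \<Psi>_def case_prod_unfold by (intro continuous_intros)
  then have "isCont \<Psi> (0, 0)" by (simp add: continuous_on_eq_continuous_at)
  then have "\<exists>\<rho>>0. \<forall>uv. dist (0, 0) uv < \<rho> \<longrightarrow> \<Psi> uv \<noteq> 0"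
    by (rule continuous_at_avoid) (use w0 in \<open>simp add: \<Psi>_def\<close>)
  then obtain \<rho> where "\<rho> > 0" and near: "\<And>uv. dist (0, 0) uv < \<rho> \<Longrightarrow> \<Psi> uv \<noteq> 0"
    by blast
  have bounded: "cmod s \<le> 2 / \<rho>" if "F (b, s) = 0" "0 \<le> b" "b \<le> 1" for b s
  proof (rule ccontr)
    assume "\<not> cmod s \<le> 2 / \<rho>"
    then have large: "2 / \<rho> < cmod s" by simp
    moreover have "0 < 2 / \<rho>" using \<open>\<rho> > 0\<close> by simp
    ultimately have "s \<noteq> 0" by auto
    have inv: "1 / cmod s < \<rho> / 2" using large \<open>s \<noteq> 0\<close> \<open>\<rho> > 0\<close> by (simp add: field_simps)
    have "dist (0, 0) (1 / s, of_real b / s) \<le> 1 / cmod s + b / cmod s"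
      using norm_Pair_le[of "1 / s" "of_real b / s"] \<open>0 \<le> b\<close>
      by (simp add: dist_norm norm_Pair norm_divide)
    also have "\<dots> \<le> 1 / cmod s + 1 / cmod s"
      using \<open>b \<le> 1\<close> by (intro add_left_mono divide_right_mono) auto
    also have "\<dots> < \<rho>" using inv by simp
    finally have "\<Psi> (1 / s, of_real b / s) \<noteq> 0" by (rule near)
    moreover have "F (b, s) = s ^ d * \<Psi> (1 / s, of_real b / s)"
      unfolding F_def \<Psi>_def case_prod_conv hom[symmetric] using \<open>s \<noteq> 0\<close>
      by (simp add: distrib_left mult.assoc[symmetric] add_ac)
    ultimately show False using \<open>F (b, s) = 0\<close> \<open>s \<noteq> 0\<close> by simp
  qed
  have contF: "continuous_on UNIV F"
    unfolding F_def case_prod_unfold by (intro continuous_intros)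
  \<comment> \<open>The parameters in the unit interval with their roots in the closed upper half
    plane; compactness supplies a smallest \<open>b\<close>.\<close>
  define Z where "Z = ({0..1} \<times> (cball 0 (2 / \<rho>) \<inter> {s. 0 \<le> Im s})) \<inter> F -` {0}"
  have "compact Z" unfolding Z_def
  proof (intro compact_Int_closed compact_Times compact_Icc compact_cball)
    show "closed {s. 0 \<le> Im s}" by (rule closed_halfspace_Im_ge)
    show "closed (F -` {0})" using closed_singleton contF by (rule closed_vimage)
  qed
  moreover have "(1, s) \<in> Z"
    using root bounded[of 1 s] \<open>0 \<le> Im s\<close> by (auto simp: Z_def F_def)
  ultimately have "\<exists>z\<in>Z. \<forall>z'\<in>Z. fst z \<le> fst z'"
    by (intro continuous_attains_inf continuous_intros) auto
  then obtain z where z: "z \<in> Z" "\<And>z'. z' \<in> Z \<Longrightarrow> fst z \<le> fst z'" by blast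
  obtain b s' where "z = (b, s')" by (cases z)
  with z have Z: "(b, s') \<in> Z" and min0: "\<And>z'. z' \<in> Z \<Longrightarrow> b \<le> fst z'" by simp_all
  have min: "b \<le> b'" if "(b', s) \<in> Z" for b' s using min0[OF that] by simp
  have b: "0 \<le> b" "b \<le> 1" "0 \<le> Im s'" "F (b, s') = 0" using Z by (auto simp: Z_def)
  have "b \<noteq> 0" using start[of s'] b by auto
  have "Im s' \<noteq> 0" 
  proof
    assume "Im s' = 0"
    then have "of_real (Re s') = s'" by (simp add: complex_eq_iff)
    then show False using noreal[of b "Re s'"] b(4) by simp
  qed
  define \<delta> where "\<delta> = Im s'"
  have "\<delta> > 0" using b \<open>Im s' \<noteq> 0\<close> by (simp add: \<delta>_def)
  \<comment> \<open>Minimality of \<open>b\<close> puts every root for \<open>b'\<close> below the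
    real axis. Degree and leading coefficient do not vary with \<open>b'\<close>, so the bound
    passes to the limit and contradicts the root at \<open>b\<close>.\<close>
  have lower: "cmod (complex_eval p (\<lambda>i. of_real (w $ i))) * \<delta> ^ d \<le> cmod (F (b', s'))"
    if "0 \<le> b'" "b' < b" for b'
  proof -
    define q where "q = complex_line p (\<lambda>i. \<i> * \<alpha> * e $ i + b' * x $ i) (\<lambda>i. of_real (w $ i))"
    have pq: "poly q s = F (b', s)" for s
      by (simp add: q_def F_def poly_complex_line algebra_simps)
    have "coeff q d = complex_eval p (\<lambda>i. of_real (w $ i))" by (simp add: q_def top)
    moreover from this have "degree q = d"
      using w0 by (intro antisym le_degree) (auto simp: q_def deg)
    ultimately have lc: "lead_coeff q = complex_eval p (\<lambda>i. of_real (w $ i))" by simp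
    have "\<delta> \<le> cmod (s' - r)" if "poly q r = 0" for r
    proof -
      have "(b', r) \<notin> Z" using min[of b' r] \<open>b' < b\<close> by auto
      then have "Im r < 0"
        using that bounded[of b' r] \<open>0 \<le> b'\<close> \<open>b' < b\<close> b by (auto simp: Z_def pq not_le)
      then show ?thesis using abs_Im_le_cmod[of "s' - r"] by (simp add: \<delta>_def)
    qed
    moreover have "q \<noteq> 0" using lc w0 by auto
    ultimately show ?thesis
      using cmod_poly_ge_if_roots_far[of q \<delta> s'] lc \<open>degree q = d\<close> \<open>\<delta> > 0\<close>
      by (auto simp: pq)
  qed
  have "continuous_on UNIV (\<lambda>b'. F (b', s'))"
    unfolding F_def case_prod_conv by (intro continuous_intros)
  then have "((\<lambda>b'. F (b', s')) \<longlongrightarrow> F (b, s')) (at_left b)"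
    by (simp add: continuous_on_eq_continuous_at isCont_def filterlim_at_split)
  then have "((\<lambda>b'. cmod (F (b', s'))) \<longlongrightarrow> cmod (F (b, s'))) (at_left b)"
    by (rule tendsto_norm)
  moreover have "\<forall>\<^sub>F b' in at_left b. cmod (complex_eval p (\<lambda>i. of_real (w $ i))) * \<delta> ^ d \<le> cmod (F (b', s'))"
    using b(1) \<open>b \<noteq> 0\<close> unfolding eventually_at_left_field
    by (intro exI[of _ 0]) (auto intro: lower)
  ultimately have "cmod (complex_eval p (\<lambda>i. of_real (w $ i))) * \<delta> ^ d \<le> cmod (F (b, s'))"
    by (rule tendsto_lowerbound) simp
  then show False using b(4) w0 \<open>\<delta> > 0\<close>
    by (metis mult_pos_pos norm_zero not_le zero_less_norm_iff zero_less_power)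
qed

text \<open>Moving \<open>w\<close> by \<open>- \<epsilon> *\<^sub>R e\<close> stays in the cone for
  small \<open>\<epsilon>\<close> and shifts every root down by \<open>\<epsilon>\<close>.\<close>

lemma interior_hyperbolicity_cone_root_pos:
  assumes "w \<in> interior (hyperbolicity_cone p e)" "poly (line_poly p e w) t = 0"
  shows "0 < t"
proof -
  obtain \<epsilon> where "\<epsilon> > 0" "w + \<epsilon> *\<^sub>R (- e) \<in> interior (hyperbolicity_cone p e)"
    using open_add_small_multiple[OF open_interior assms(1)] .
  then have "w + \<epsilon> *\<^sub>R (- e) \<in> hyperbolicity_cone p e"
    using interior_subset by blast
  moreover have "poly (line_poly p e (w + \<epsilon> *\<^sub>R (- e))) (t - \<epsilon>) = 0"
    using assms(2) by (simp add: poly_line_poly algebra_simps)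
  ultimately have "0 \<le> t - \<epsilon>" unfolding hyperbolicity_cone_def by blast
  then show ?thesis using \<open>\<epsilon> > 0\<close> by simp
qed

lemma hyperbolic_complex_eval_nonzero:
  fixes p :: "'m::finite mpoly" and x w :: "real ^ 'm"
  assumes "hyperbolic p e" "w \<in> interior (hyperbolicity_cone p e)"
  shows "complex_eval p (\<lambda>i. x $ i + \<i> * w $ i) \<noteq> 0"
proof -
  \<comment> \<open>split \<open>\<i> w = \<i> \<alpha> e + \<i> (w - \<alpha> e)\<close>\<close>
  obtain \<alpha> where "\<alpha> > 0" "w + \<alpha> *\<^sub>R (- e) \<in> interior (hyperbolicity_cone p e)"
    using open_add_small_multiple[OF open_interior assms(2)] .
  then have "complex_eval p (\<lambda>i. \<i> * \<alpha> * e $ i + \<i> * (w + \<alpha> *\<^sub>R (- e)) $ i + x $ i) \<noteq> 0"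
    using assms(1) interior_hyperbolicity_cone_root_pos
    by (intro hyperbolic_no_root_half_plane) auto
  then show ?thesis by (simp add: algebra_simps)
qed

section \<open>The logarithmic barrier continued to complex parameters\<close>

text \<open>On negative numbers the library sets \<open>ln x = ln (- x)\<close>.\<close>

lemma DERIV_ln_nonzero:
  fixes x :: real
  assumes "x \<noteq> 0"
  shows "(ln has_real_derivative 1 / x) (at x)"
proof (cases "x > 0")
  case False
  then have "((\<lambda>y. ln (- y)) has_real_derivative 1 / x) (at x)"
    using assms by (auto intro!: derivative_eq_intros)
  then show ?thesis by (simp add: ln_minus)
qed (rule DERIV_ln_divide)

text \<open>Coefficients 0 and 1 of the line polynomial are the value of \<open>p\<close> at
  \<open>v\<close> and its derivative in direction \<open>u\<close>. The quotient of complex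
  coefficients still makes sense when \<open>v\<close> is replaced by a complex point.\<close>

lemma inner_gradient_neg_ln:
  fixes p :: "'m::finite mpoly" and f :: "real ^ 'm \<Rightarrow> real"
  assumes "open S" "v \<in> S" and f: "\<And>x. x \<in> S \<Longrightarrow> f x = - ln (mpoly_eval p x)"
    and "f differentiable (at v)" "mpoly_eval p v \<noteq> 0"
  shows "complex_of_real (u \<bullet> gradient f v)
    = - (coeff (complex_line p (\<lambda>i. of_real (v $ i)) (\<lambda>i. of_real (u $ i))) 1
       / coeff (complex_line p (\<lambda>i. of_real (v $ i)) (\<lambda>i. of_real (u $ i))) 0)"
proof -
  \<comment> \<open>The negation undoes the sign convention of \<open>line_poly\<close>.\<close>
  define q where "q = line_poly p u (- v)"
  have q: "poly q t = mpoly_eval p (v + t *\<^sub>R u)" for t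
    by (simp add: q_def poly_line_poly add.commute)
  have "poly q 0 \<noteq> 0" using assms(5) by (simp add: q)
  have "(f has_derivative (\<lambda>h. h \<bullet> gradient f v)) (at v)"
    using GDERIV_gradient[OF assms(4)] by (simp add: gderiv_def)
  then have "(f has_derivative (\<lambda>h. h \<bullet> gradient f v)) (at (v + 0 *\<^sub>R u))" by simp
  then have "((\<lambda>t. f (v + t *\<^sub>R u)) has_derivative (\<lambda>r. (r *\<^sub>R u) \<bullet> gradient f v)) (at 0)"
    by (rule has_derivative_compose[where f = "\<lambda>t. v + t *\<^sub>R u" and g = f, rotated])
       (auto intro!: derivative_eq_intros)
  then have D1: "((\<lambda>t. f (v + t *\<^sub>R u)) has_real_derivative u \<bullet> gradient f v) (at 0)"
    by (simp add: has_field_derivative_def mult_commute_abs)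
  have "((\<lambda>t. - ln (poly q t)) has_real_derivative - (1 / poly q 0 * poly (pderiv q) 0)) (at 0)"
    by (intro DERIV_minus DERIV_chain2[OF DERIV_ln_nonzero poly_DERIV] \<open>poly q 0 \<noteq> 0\<close>)
  moreover have "open ((\<lambda>t. v + t *\<^sub>R u) -` S)"
    by (rule open_vimage[OF \<open>open S\<close>]) (intro continuous_intros)
  ultimately have "((\<lambda>t. f (v + t *\<^sub>R u)) has_real_derivative - (1 / poly q 0 * poly (pderiv q) 0)) (at 0)"
    by (rule has_field_derivative_transform_within_open) (use assms(2) f q in auto)
  from DERIV_unique[OF D1 this] have "u \<bullet> gradient f v = - (coeff q 1 / coeff q 0)"
    by (simp add: poly_0_coeff_0 coeff_pderiv)
  moreover have "complex_line p (\<lambda>i. of_real (v $ i)) (\<lambda>i. of_real (u $ i)) = map_poly of_real q"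
    by (simp add: q_def map_poly_line_poly)
  ultimately show ?thesis by (simp add: coeff_map_poly)
qed

text \<open>Every coefficient is a polynomial in \<open>s\<close>. The predicate \<open>D\<close>
  treats all coefficients at once because a coefficient of a product involves several coefficients
  of each factor.\<close>

lemma field_differentiable_coeff_complex_line:
  fixes x v :: "'m::finite \<Rightarrow> complex" and z :: "'m \<Rightarrow> complex"
  shows "(\<lambda>s. coeff (complex_line p (\<lambda>i. x i + s * z i) v) n) field_differentiable (at s)"
proof -
  define D where "D = (\<lambda>Q :: complex \<Rightarrow> complex poly. \<forall>n. (\<lambda>s. coeff (Q s) n) field_differentiable (at s))"
  have mult: "D (\<lambda>s. P s * Q s)" if "D P" "D Q" for P Q
    using that unfolding D_def coeff_mult
    by (auto intro!: field_differentiable_sum field_differentiable_mult)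
  have const: "D (\<lambda>s. 1)" by (simp add: D_def)
  have lin: "D (\<lambda>s. [:x i + s * z i, v i:])" for i
    unfolding D_def
  proof
    fix n
    show "(\<lambda>s. coeff [:x i + s * z i, v i:] n) field_differentiable (at s)"
      by (cases n) (auto intro!: derivative_intros field_differentiable_add field_differentiable_mult)
  qed
  have pow: "D (\<lambda>s. [:x i + s * z i, v i:] ^ k)" for i k
  proof (induction k)
    case (Suc k)
    then show ?case unfolding power_Suc by (rule mult[OF lin])
  qed (simp add: const)
  have prod: "D (\<lambda>s. \<Prod>i\<in>S. [:x i + s * z i, v i:] ^ k i)" if "finite S" for S k
    using that by (induction S) (auto simp: const intro: mult pow)
  show ?thesis
    unfolding complex_line_def coeff_sum coeff_smult
    using prod[OF finite_class.finite_UNIV]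
    by (intro field_differentiable_sum field_differentiable_mult field_differentiable_const) (simp add: D_def)
qed

text \<open>Along the imaginary axis, \<open>Im (G (\<i> * \<epsilon>))\<close> has derivative
  \<open>Im (\<i> * D)\<close>, which is \<open>Re D\<close>, at \<open>\<epsilon> = 0\<close>; a
  positive value would push it above 0.\<close>

lemma Re_derivative_nonpos_if_Im_nonpos:
  fixes G :: "complex \<Rightarrow> complex"
  assumes "(G has_field_derivative D) (at 0)" "Im (G 0) = 0"
    and "\<And>\<epsilon>. 0 < \<epsilon> \<Longrightarrow> Im (G (\<i> * of_real \<epsilon>)) \<le> 0"
  shows "Re D \<le> 0"
proof (rule ccontr)
  assume "\<not> Re D \<le> 0"
  have "((\<lambda>z. G (\<i> * z)) has_field_derivative D * \<i>) (at (of_real 0))"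
    using DERIV_chain2[of G D "\<lambda>z. \<i> * z" "0" \<i>] assms(1) by (auto intro!: derivative_eq_intros)
  then have "((\<lambda>\<epsilon>. G (\<i> * of_real \<epsilon>)) has_vector_derivative D * \<i>) (at 0)"
    by (rule has_vector_derivative_real_field)
  then have "((\<lambda>\<epsilon>. Im (G (\<i> * of_real \<epsilon>))) has_real_derivative Re D) (at 0)"
    unfolding has_real_derivative_iff_has_vector_derivative
    by (auto dest: bounded_linear.has_vector_derivative[OF bounded_linear_Im])
  then obtain d where "d > 0" "\<And>h. 0 < h \<Longrightarrow> h < d \<Longrightarrow> Im (G (\<i> * of_real 0)) < Im (G (\<i> * of_real (0 + h)))"
    using DERIV_pos_inc_right[of "\<lambda>\<epsilon>. Im (G (\<i> * of_real \<epsilon>))" "Re D" 0] \<open>\<not> Re D \<le> 0\<close> by auto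
  from this(2)[of "d / 2"] \<open>d > 0\<close> show False
    using assms(2) assms(3)[of "d / 2"] by simp
qed

text \<open>On real parameters near 0, \<open>- G\<close> is the derivative of \<open>f\<close> in
  direction \<open>u\<close> along \<open>y + s *\<^sub>R z\<close>, so the Hessian form is
  \<open>- D\<close>. On the positive imaginary axis, root location gives \<open>G\<close>
  nonpositive imaginary part.\<close>

lemma hyperbolic_hessian_nonneg_interior:
  fixes f :: "real ^ 'm \<Rightarrow> real" and p :: "'m mpoly"
  assumes scb: "self_concordant_barrier C f"
    and hyp: "hyperbolic p e" and C: "C = hyperbolicity_cone p e"
    and f: "\<And>y. y \<in> interior C \<Longrightarrow> f y = - ln (mpoly_eval p y)"
    and y: "y \<in> interior C" and u: "u \<in> interior C" and z: "z \<in> interior C"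
  shows "0 \<le> u \<bullet> (hessian f y *v z)"
proof -
  have cone: "convex_cone C" using scb by (simp add: self_concordant_barrier_def)
  have diff: "f differentiable (at v)" "gradient f differentiable (at v)" if "v \<in> interior C" for v
    using scb that by (auto simp: self_concordant_barrier_def three_times_differentiable_on_def)
  have stable: "complex_eval p (\<lambda>i. x $ i + \<i> * w $ i) \<noteq> 0" if "w \<in> interior C" for x w :: "real ^ 'm"
    using hyperbolic_complex_eval_nonzero[OF hyp] that by (simp add: C)
  obtain d where hom: "\<And>c x. complex_eval p (\<lambda>i. c * x i) = c ^ d * complex_eval p x"
  proof -
    have "homogeneous p" using hyp by (simp add: hyperbolic_def)
    then show thesis by (rule homogeneousE) (rule that)
  qed
  \<comment> \<open>Homogeneity strips the factor \<open>\<i>\<close> from the purely imaginary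
    point supplied by \<open>stable\<close>.\<close>
  have real: "complex_eval p (\<lambda>i. of_real (v $ i)) \<noteq> 0" if "v \<in> interior C" for v
    using stable[OF that, of 0] by (simp add: hom)
  define L where "L = (\<lambda>s :: complex. complex_line p (\<lambda>i. y $ i + s * z $ i) (\<lambda>i. of_real (u $ i)))"
  define G where "G = (\<lambda>s :: complex. coeff (L s) 1 / coeff (L s) 0)"
  have L0: "coeff (L s) 0 = complex_eval p (\<lambda>i. y $ i + s * z $ i)" for s
    unfolding L_def poly_0_coeff_0[symmetric] poly_complex_line by simp
  have "coeff (L 0) 0 \<noteq> 0" using real[OF y] L0[of 0] by simp
  then have "G field_differentiable (at 0)"
    unfolding G_def L_def
    by (intro field_differentiable_divide field_differentiable_coeff_complex_line) simp
  then obtain D where D: "(G has_field_derivative D) (at 0)"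
    unfolding field_differentiable_def by blast
  define T where "T = (\<lambda>s :: real. y + s *\<^sub>R z) -` interior C"
  have "open T" unfolding T_def by (rule open_vimage) (auto intro!: continuous_intros)
  have "0 \<in> T" using y by (simp add: T_def)
  have grad: "- G (of_real s) = of_real (u \<bullet> gradient f (y + s *\<^sub>R z))" if "s \<in> T" for s
  proof -
    have v: "y + s *\<^sub>R z \<in> interior C" using that by (simp add: T_def)
    have "mpoly_eval p (y + s *\<^sub>R z) \<noteq> 0"
      using real[OF v] unfolding complex_eval_of_real by simp
    from inner_gradient_neg_ln[OF open_interior v f diff(1)[OF v] this]
    show ?thesis by (simp add: G_def L_def)
  qed
  have F: "(gradient f has_derivative (*v) (hessian f y)) (at (y + 0 *\<^sub>R z))"
    using has_derivative_hessian[OF diff(2)[OF y]] by simp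
  have "((\<lambda>s. u \<bullet> gradient f (y + s *\<^sub>R z)) has_derivative (\<lambda>r. u \<bullet> (hessian f y *v (r *\<^sub>R z)))) (at 0)"
    by (intro has_derivative_inner_right
        has_derivative_compose[where f = "\<lambda>s. y + s *\<^sub>R z" and g = "gradient f", OF _ F])
      (auto intro!: derivative_eq_intros)
  then have "((\<lambda>s. u \<bullet> gradient f (y + s *\<^sub>R z)) has_vector_derivative u \<bullet> (hessian f y *v z)) (at 0)"
    by (simp add: has_vector_derivative_def matrix_vector_mult_scaleR)
  then have "((\<lambda>s. complex_of_real (u \<bullet> gradient f (y + s *\<^sub>R z))) has_vector_derivative
      of_real (u \<bullet> (hessian f y *v z))) (at 0)"
    by (rule bounded_linear.has_vector_derivative[OF bounded_linear_of_real])
  \<comment> \<open>The same real-parameter function is differentiated a second time, now through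
    the complex derivative of \<open>G\<close>.\<close>
  moreover have "((\<lambda>s. complex_of_real (u \<bullet> gradient f (y + s *\<^sub>R z))) has_vector_derivative - D) (at 0)"
  proof (rule has_vector_derivative_transform_within_open)
    have "((\<lambda>s. - G s) has_field_derivative - D) (at (of_real 0))"
      using D by (auto intro!: derivative_intros)
    then show "((\<lambda>s. - G (of_real s)) has_vector_derivative - D) (at 0)"
      by (rule has_vector_derivative_real_field)
  qed (use \<open>open T\<close> \<open>0 \<in> T\<close> grad in auto)
  ultimately have "complex_of_real (u \<bullet> (hessian f y *v z)) = - D"
    by (rule vector_derivative_unique_at)
  then have "u \<bullet> (hessian f y *v z) = - Re D"
    by (metis Re_complex_of_real uminus_complex.sel(1))
  moreover have "Re D \<le> 0"
  proof (rule Re_derivative_nonpos_if_Im_nonpos[OF D])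
    have "- G 0 = of_real (u \<bullet> gradient f y)" using grad[OF \<open>0 \<in> T\<close>] by simp
    then have "Im (- G 0) = 0" by simp
    then show "Im (G 0) = 0" by simp
    show "Im (G (\<i> * of_real \<epsilon>)) \<le> 0" if "0 < \<epsilon>" for \<epsilon>
      unfolding G_def
    proof (rule Im_log_derivative_nonpos)
      \<comment> \<open>The point \<open>y + \<i> * \<epsilon> * z + t * u\<close> has imaginary
        part \<open>\<epsilon> *\<^sub>R z + Im t *\<^sub>R u\<close>, interior to the cone, so
        \<open>stable\<close> excludes a zero.\<close>
      have nz: "poly (L (\<i> * of_real \<epsilon>)) t \<noteq> 0" if "0 \<le> Im t" for t
      proof -
        have "\<epsilon> *\<^sub>R z + Im t *\<^sub>R u \<in> interior C"
          using u interior_subset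
          by (intro interior_add_convex_cone convex_cone_scaleR interior_convex_cone_scaleR cone z that \<open>0 < \<epsilon>\<close>) auto
        from stable[OF this, of "y + Re t *\<^sub>R u"]
        have "complex_eval p (\<lambda>i. (y + Re t *\<^sub>R u) $ i + \<i> * (\<epsilon> *\<^sub>R z + Im t *\<^sub>R u) $ i) \<noteq> 0" .
        moreover have "(\<lambda>i. complex_of_real ((y + Re t *\<^sub>R u) $ i) + \<i> * of_real ((\<epsilon> *\<^sub>R z + Im t *\<^sub>R u) $ i))
            = (\<lambda>i. (y $ i + (\<i> * of_real \<epsilon>) * z $ i) + t * u $ i)"
          by (simp add: fun_eq_iff complex_eq_iff)
        ultimately show ?thesis unfolding L_def poly_complex_line by (simp only: not_False_eq_True)
      qed
      show "L (\<i> * of_real \<epsilon>) \<noteq> 0" using nz[of 0] by auto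
      show "Im t < 0" if "poly (L (\<i> * of_real \<epsilon>)) t = 0" for t
        using nz[of t] that not_le by blast
    qed
  qed
  ultimately show ?thesis by simp
qed

text \<open>Adding \<open>\<epsilon> *\<^sub>R y\<close> moves both \<open>u\<close> and
  \<open>z\<close> into the interior; the bilinear form is continuous as \<open>\<epsilon>\<close>
  tends to 0.\<close>

lemma hyperbolic_hessian_nonneg:
  fixes f :: "real ^ 'm \<Rightarrow> real" and p :: "'m mpoly"
  assumes scb: "self_concordant_barrier C f"
    and hyp: "hyperbolic p e" and C: "C = hyperbolicity_cone p e"
    and f: "\<And>y. y \<in> interior C \<Longrightarrow> f y = - ln (mpoly_eval p y)"
    and y: "y \<in> interior C" and u: "u \<in> C" and z: "z \<in> C"
  shows "0 \<le> u \<bullet> (hessian f y *v z)"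
proof (rule tendsto_lowerbound)
  have cone: "convex_cone C" using scb by (simp add: self_concordant_barrier_def)
  let ?h = "\<lambda>\<epsilon>::real. (u + \<epsilon> *\<^sub>R y) \<bullet> (hessian f y *v (z + \<epsilon> *\<^sub>R y))"
  have "(?h \<longlongrightarrow> ?h 0) (at_right 0)"
    unfolding matrix_vector_right_distrib matrix_vector_mult_scaleR by (intro tendsto_intros)
  then show "(?h \<longlongrightarrow> u \<bullet> (hessian f y *v z)) (at_right 0)" by simp
  have int: "v + \<epsilon> *\<^sub>R y \<in> interior C" if "v \<in> C" "0 < \<epsilon>" for v \<epsilon>
    using interior_add_convex_cone[OF cone interior_convex_cone_scaleR[OF cone y that(2)] that(1)]
    by (simp add: add.commute)
  show "\<forall>\<^sub>F \<epsilon> in at_right 0. 0 \<le> ?h \<epsilon>"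
    using eventually_at_right_less[of 0]
  proof eventually_elim
    case (elim \<epsilon>)
    then show ?case
      by (intro hyperbolic_hessian_nonneg_interior[OF scb hyp C f y] int u z)
  qed
qed simp

theorem theorem2p1:
  fixes K :: "(real ^ 'm) set"
    and f :: "real ^ 'm \<Rightarrow> real"
  assumes "proper_cone K"
    and "self_concordant_barrier (dual_cone K) f"
  shows "(\<forall>y\<in>interior (dual_cone K). \<forall>z\<in>dual_cone K. augmented_hessian f y *v z \<in> K) \<and>
    (\<forall>(p :: 'm mpoly) e.
       hyperbolic p e \<and> dual_cone K = hyperbolicity_cone p e \<and>
       (\<forall>y\<in>interior (dual_cone K). f y = - ln (mpoly_eval p y)) \<longrightarrow>
       (\<forall>y\<in>interior (dual_cone K). \<forall>z\<in>dual_cone K. hessian f y *v z \<in> K))"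
proof (intro conjI allI impI ballI)
  have cone: "convex_cone K" "closed K" using assms(1) by (auto simp: proper_cone_def)
  show "augmented_hessian f y *v z \<in> K"
    if "y \<in> interior (dual_cone K)" "z \<in> dual_cone K" for y z
    using scb_augmented_hessian_nonneg[OF assms(2) that(1) _ that(2)] by (rule bipolar[OF cone])
  show "hessian f y *v z \<in> K"
    if "hyperbolic p e \<and> dual_cone K = hyperbolicity_cone p e \<and>
        (\<forall>y\<in>interior (dual_cone K). f y = - ln (mpoly_eval p y))"
      "y \<in> interior (dual_cone K)" "z \<in> dual_cone K" for p :: "'m mpoly" and e y z
  proof (rule bipolar[OF cone])
    fix u assume "u \<in> dual_cone K"
    with that show "0 \<le> u \<bullet> (hessian f y *v z)"
      by (intro hyperbolic_hessian_nonneg[OF assms(2), of p e]) auto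
  qed
qed

end
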